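(* Let $C$ be a $d$-variate Archimedean copula with generator $\phi$ and let $(U_1,\ldots,U_d)$ have distribution function $C$. Suppose that $\phi(0)=\infty$, that $$\lim_{s\downarrow 0}\frac{s\,\phi'(s)}{\phi(s)}=0,$$ and that the function $\psi=-1/D(\log\phi^{\leftarrow})$ is regularly varying at infinity of finite index $\kappa$. For $0<s<1$ and $y\in[0,\infty]$ put $\chi_s(y)=\phi^{\leftarrow}(y^{-1}\psi(\phi(s)))$. Then for every $\varnothing\neq I\subset\{1,\ldots,d\}$, every $(x_i)_{i\in I}\in(0,\infty)^{|I|}$ and every $(y_1,\ldots,y_d)\in(0,\infty)^d$, $$\lim_{s\downarrow 0}\Pr[\forall i\in I: U_i\leq s y_i;\ \forall i\in I^c: U_i\leq\chi_s(y_i)\mid\forall i\in I: U_i\leq s x_i]=\prod_{i\in I}\Bigl(\frac{y_i}{x_i}\wedge 1\Bigr)^{|I|^{-\kappa}}\prod_{i\in I^c}\exp\bigl(-|I|^{-\kappa}y_i^{-1}\bigr).$$ Moreover, the function $\chi_s$ has the following properties: (i) the map $[0,\infty]\to[0,1]: y\mapsto\chi_s(y)$ is an increasing homeomorphism for all $0<s<1$; (ii) $\lim_{s\downarrow 0}s/\chi_s(y)=0$ for all $0<y<\infty$.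
   Context: Fix an integer $d\geq 2$. An Archimedean generator is a convex, decreasing function $\phi:[0,1]\to[0,\infty]$ with $\phi(1)=0$; its generalized inverse is $\phi^{\leftarrow}(y)=\inf\{t\in[0,1]:\phi(t)\leq y\}$ for $y\in[0,\infty]$. The Archimedean copula with generator $\phi$ is $C(u_1,\ldots,u_d)=\phi^{\leftarrow}(\phi(u_1)+\cdots+\phi(u_d))$ on $[0,1]^d$; it is assumed throughout that $C$ is indeed a copula, i.e. (the restriction to $[0,1]^d$ of) a distribution function with uniform$(0,1)$ margins (equivalently, $\phi^{\leftarrow}$ is $d$-monotone on $(0,\infty)$). $\phi'$ denotes a non-decreasing version of the Radon-Nikodym derivative of $\phi$. $D$ is the derivative operator; the derivative of $\phi^{\leftarrow}$ is taken consistently with $\phi'$, so that $\psi(t)=-\phi^{\leftarrow}(t)\,\phi'(\phi^{\leftarrow}(t))$ and $\psi(\phi(s))=-s\phi'(s)$. A positive measurable function $f$ defined in a neighbourhood of infinity is regularly varying at infinity of finite index $\kappa\in\mathbb{R}$ if $f(tx)/f(t)\to x^{\kappa}$ as $t\to\infty$ for every $x>0$. Conventions: $0^{-1}=\infty$, $\infty^{-1}=0$, $\wedge$ is minimum, $I^c=\{1,\ldots,d\}\setminus I$, and an empty product is $1$. *)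

theory Defs
  imports "HOL-Probability.Probability"
begin

text \<open>The half-line $[0,\infty]$ is the type \<^typ>\<open>ennreal\<close>, in which \<^term>\<open>inverse\<close> satisfies
  $0^{-1}=\infty$ and $\infty^{-1}=0$. A generator is a function on all of \<^typ>\<open>real\<close> of which only
  the values on $[0,1]$ matter.\<close>

text \<open>Decreasing is meant in the weak sense. For generators of copulas it amounts to strict
  monotonicity, since the first margin of the copula is $\phi^{\leftarrow}\circ\phi$.\<close>

definition archimedean_generator :: "(real \<Rightarrow> ennreal) \<Rightarrow> bool" where
  "archimedean_generator \<phi> \<longleftrightarrow>
     (\<forall>x\<in>{0..1}. \<forall>y\<in>{0..1}. \<forall>u\<in>{0..1}.
        \<phi> ((1 - u) * x + u * y) \<le> ennreal (1 - u) * \<phi> x + ennreal u * \<phi> y) \<and>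
     antimono_on {0..1} \<phi> \<and> \<phi> 1 = 0"

definition gen_inverse :: "(real \<Rightarrow> ennreal) \<Rightarrow> ennreal \<Rightarrow> real" where
  "gen_inverse \<phi> y = Inf {t \<in> {0..1}. \<phi> t \<le> y}"

definition archimedean_copula :: "nat \<Rightarrow> (real \<Rightarrow> ennreal) \<Rightarrow> (nat \<Rightarrow> real) \<Rightarrow> real" where
  "archimedean_copula d \<phi> u = gen_inverse \<phi> (\<Sum>i\<in>{1..d}. \<phi> (u i))"

text \<open>The random vector $(X_1,\ldots,X_d)$ on \<open>M\<close> has a distribution function whose restriction to
  $[0,1]^d$ is \<open>C\<close>.\<close>

definition has_distribution_function ::
    "nat \<Rightarrow> 'a measure \<Rightarrow> (nat \<Rightarrow> 'a \<Rightarrow> real) \<Rightarrow> ((nat \<Rightarrow> real) \<Rightarrow> real) \<Rightarrow> bool" where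
  "has_distribution_function d M X C \<longleftrightarrow>
     (\<forall>i\<in>{1..d}. X i \<in> borel_measurable M) \<and>
     (\<forall>u. (\<forall>i\<in>{1..d}. u i \<in> {0..1}) \<longrightarrow>
        measure M {\<omega> \<in> space M. \<forall>i\<in>{1..d}. X i \<omega> \<le> u i} = C u)"

definition is_copula :: "nat \<Rightarrow> ((nat \<Rightarrow> real) \<Rightarrow> real) \<Rightarrow> bool" where
  "is_copula d C \<longleftrightarrow>
     (\<exists>N :: (nat \<Rightarrow> real) measure.
        prob_space N \<and> sets N = sets (Pi\<^sub>M {1..d} (\<lambda>_. borel)) \<and>
        has_distribution_function d N (\<lambda>i x. x i) C \<and>
        (\<forall>i\<in>{1..d}. distr N borel (\<lambda>x. x i) = uniform_measure lborel {0<..<1}))"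

text \<open>A non-decreasing version of the Radon--Nikodym derivative of \<open>\<phi>\<close>. This is only used for
  generators of copulas, which are finite on $(0,1]$, so that \<^term>\<open>enn2real\<close> loses nothing; the
  value of \<open>\<phi>'\<close> at the endpoints (possibly $-\infty$ at $0$) is left open.\<close>

definition generator_derivative :: "(real \<Rightarrow> ennreal) \<Rightarrow> (real \<Rightarrow> real) \<Rightarrow> bool" where
  "generator_derivative \<phi> \<phi>' \<longleftrightarrow>
     mono_on {0<..<1} \<phi>' \<and>
     (\<forall>a b. 0 < a \<and> a \<le> b \<and> b \<le> 1 \<longrightarrow>
        set_integrable lborel {a..b} \<phi>' \<and>
        enn2real (\<phi> b) - enn2real (\<phi> a) = (LINT t:{a..b}|lborel. \<phi>' t))"

text \<open>The version of $D\phi^{\leftarrow}$ on $(0,\infty)$ that is consistent with \<open>\<phi>'\<close> (the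
  ordinary derivative need not exist everywhere).\<close>

definition D_gen_inverse :: "(real \<Rightarrow> ennreal) \<Rightarrow> (real \<Rightarrow> real) \<Rightarrow> real \<Rightarrow> real" where
  "D_gen_inverse \<phi> \<phi>' t = 1 / \<phi>' (gen_inverse \<phi> (ennreal t))"

text \<open>$\psi=-1/D(\log\phi^{\leftarrow})$.\<close>

definition psi :: "(real \<Rightarrow> ennreal) \<Rightarrow> (real \<Rightarrow> real) \<Rightarrow> real \<Rightarrow> real" where
  "psi \<phi> \<phi>' t = - 1 / (D_gen_inverse \<phi> \<phi>' t / gen_inverse \<phi> (ennreal t))"

lemma psi_eq:
  "psi \<phi> \<phi>' t = - gen_inverse \<phi> (ennreal t) * \<phi>' (gen_inverse \<phi> (ennreal t))"
  by (simp add: psi_def D_gen_inverse_def)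

definition chi :: "(real \<Rightarrow> ennreal) \<Rightarrow> (real \<Rightarrow> real) \<Rightarrow> real \<Rightarrow> ennreal \<Rightarrow> real" where
  "chi \<phi> \<phi>' s y = gen_inverse \<phi> (inverse y * ennreal (psi \<phi> \<phi>' (enn2real (\<phi> s))))"

definition regularly_varying_at_infinity :: "(real \<Rightarrow> real) \<Rightarrow> real \<Rightarrow> bool" where
  "regularly_varying_at_infinity f \<kappa> \<longleftrightarrow>
     (\<exists>a. (\<forall>t>a. f t > 0) \<and> f \<in> borel_measurable (restrict_space borel {a<..})) \<and>
     (\<forall>x>0. ((\<lambda>t. f (t * x) / f t) \<longlongrightarrow> x powr \<kappa>) at_top)"

end

theory Submission
  imports Defs
begin

text \<open>Write $f=\phi$, $P=\phi^{\leftarrow}$ and $q(s)=-s\phi'(s)=\psi(f(s))$. Convexity and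
  $q=o(f)$ make $f$ slowly varying at 0, so for fixed $x$ the values $f(u)$ with $u$ between $s$ and
  $sx$ are asymptotically equal; by the uniform convergence theorem for regularly varying functions so
  are the values $q(u)=\psi(f(u))$. Integrating $\phi'(u)=-q(u)/u$ gives
  $(f(sx)-f(s))/q(s)\to-\log x$, and inverting this at the point $P(kf(s))$, where
  $q(P(kf(s)))=\psi(kf(s))\sim k^{\kappa}q(s)$, gives
  $P(kf(s)+vq(s))/P(kf(s))\to\exp(-vk^{-\kappa})$. With $k=|I|$, numerator and denominator of the
  conditional probability are both of the form $P(kf(s)+(v+o(1))q(s))$.\<close>

section \<open>Uniform convergence for regularly varying functions\<close>

text \<open>The probabilities are not of size \<open>s\<close>: slow variation of \<open>f\<close>
  makes its inverse decay so fast that \<open>P (k * f s) / s\<close> tends to 0 for every k > 1.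
  Numerator and denominator are therefore both measured against \<open>P (k * f s)\<close>, which
  cancels in the quotient. Increments of order \<open>q s\<close> in the argument are those that
  change \<open>P\<close> by a constant factor, and this accounts for the two scales in the
  statement. For i in I, replacing \<open>s\<close> by \<open>s * x\<close> changes the generator by
  about \<open>- ln x * q s\<close>, while \<open>chi\<close> is built so that every other
  coordinate adds exactly \<open>q s / y\<close>. The factors of the limit are thus the exponentials
  of additive contributions. One obstacle is that \<open>\<phi>'\<close> is just a non-decreasing
  version of the derivative, so local statements about \<open>f\<close> come from integrals and
  tangent bounds. Another is that regular variation is assumed in the variable t =
  \<open>f u\<close>, whereas the limits needed are in u; slow variation of \<open>f\<close> is the
  bridge between the two.\<close>

text \<open>If uniformity fails along $x_n$, $u_n$, then most $v$ have $g(x_n+v)$ close to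
  $g(x_n)$ and most $v$ have $g(x_n+v)$ close to $g(x_n+u_n)$; the two sets meet for measure reasons.\<close>

lemma slowly_varying_uniform:
  fixes g :: "real \<Rightarrow> real"
  assumes [measurable]: "g \<in> borel_measurable borel"
    and lim: "\<And>u. ((\<lambda>x. g (x + u) - g x) \<longlongrightarrow> 0) at_top"
    and "\<epsilon> > 0"
  shows "\<forall>\<^sub>F x in at_top. \<forall>u\<in>{0..1}. \<bar>g (x + u) - g x\<bar> < \<epsilon>"
proof (rule ccontr)
  assume "\<not> ?thesis"
  then have "\<forall>n::nat. \<exists>x u. x \<ge> real n \<and> u \<in> {0..1} \<and> \<bar>g (x + u) - g x\<bar> \<ge> \<epsilon>"
    unfolding eventually_at_top_linorder by (meson not_le)
  then obtain x u where x: "\<And>n::nat. x n \<ge> real n" and u: "\<And>n. u n \<in> {0..1::real}"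
      and bad: "\<And>n. \<bar>g (x n + u n) - g (x n)\<bar> \<ge> \<epsilon>"
    by metis
  have xlim: "filterlim x at_top sequentially"
    using filterlim_at_top_mono[OF filterlim_real_sequentially, of x] x by simp
  have xulim: "filterlim (\<lambda>n. x n + u n) at_top sequentially"
    by (rule filterlim_at_top_mono[OF xlim]) (use u in auto)
  \<comment> \<open>Demanding the bound for all m \<ge> n makes the sets increase in n. By pointwise
    convergence along z they exhaust [0,2], so continuity of measure from below applies.\<close>
  define V where "V z n = {v\<in>{0..2}. \<forall>m\<ge>n. \<bar>g (z m + v) - g (z m)\<bar> < \<epsilon> / 2}"
    for z :: "nat \<Rightarrow> real" and n :: nat
  have Vsets [measurable]: "V z n \<in> sets borel" for z n
    unfolding V_def by measurable
  \<comment> \<open>The constant 3/2 is half the length of [0,3], the interval that will contain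
    both sets to be intersected.\<close>
  have Vlarge: "\<forall>\<^sub>F n in sequentially. measure lborel (V z n) > 3 / 2"
    if "filterlim z at_top sequentially" for z
  proof -
    have *: "((\<lambda>n. g (z n + v) - g (z n)) \<longlongrightarrow> 0) sequentially" for v
      using filterlim_compose[OF lim that] .
    have "(\<Union>n. V z n) = {0..2}"
    proof safe
      fix v :: real assume v: "v \<in> {0..2}"
      have "\<forall>\<^sub>F n in sequentially. \<bar>g (z n + v) - g (z n)\<bar> < \<epsilon> / 2"
        using tendstoD[OF *[of v], of "\<epsilon> / 2"] \<open>\<epsilon> > 0\<close> by simp
      then show "v \<in> (\<Union>n. V z n)"
        using v by (auto simp: V_def eventually_sequentially)
    qed (auto simp: V_def)
    moreover have "(\<lambda>n. measure lborel (V z n)) \<longlonglongrightarrow> measure lborel (\<Union>n. V z n)"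
    proof (rule Lim_measure_incseq)
      show "incseq (V z)"
        unfolding V_def incseq_def by auto
      have "emeasure lborel (\<Union>n. V z n) = ennreal 2"
        using \<open>(\<Union>n. V z n) = {0..2}\<close> by simp
      then show "emeasure lborel (\<Union>n. V z n) \<noteq> \<infinity>" by simp
    qed auto
    ultimately show ?thesis
      by (intro order_tendstoD(1)[where y = 2]) auto
  qed
  from eventually_happens[OF eventually_conj[OF Vlarge[OF xlim] Vlarge[OF xulim]]]
  obtain n where n: "measure lborel (V x n) > 3 / 2"
      "measure lborel (V (\<lambda>n. x n + u n) n) > 3 / 2"
    by auto
  \<comment> \<open>The translate by \<open>u n\<close> re-centres the second set: v lies in
    \<open>W\<close> iff v - \<open>u n\<close> is good for the base point \<open>x n + u n\<close>,
    that is, iff g(\<open>x n\<close> + v) stays close to g(\<open>x n + u n\<close>) from n on in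
    the corresponding sense. Since \<open>u n\<close> \<le> 1, the translate stays in [0,3].\<close>
  define W where "W = (+) (- u n) -` V (\<lambda>n. x n + u n) n"
  have W_sets [measurable]: "W \<in> sets borel"
    unfolding W_def using measurable_sets[of "(+) (- u n)" borel borel] by simp
  have "emeasure lborel W = emeasure lborel (V (\<lambda>n. x n + u n) n)"
  proof -
    have "emeasure lborel (V (\<lambda>n. x n + u n) n)
        = emeasure (distr lborel borel ((+) (- u n))) (V (\<lambda>n. x n + u n) n)"
      by (simp add: lborel_distr_plus)
    also have "\<dots> = emeasure lborel W"
      using Vsets[of "\<lambda>n. x n + u n" n] by (subst emeasure_distr) (auto simp: W_def)
    finally show ?thesis ..
  qed
  then have mW: "measure lborel W > 3 / 2"
    using n by (simp add: measure_def)
  have sub: "V x n \<subseteq> {0..3}" "W \<subseteq> {0..3}"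
    using u[of n] by (auto simp: V_def W_def)
  have fin: "emeasure lborel A \<noteq> \<infinity>" if "A \<subseteq> {0..3}" for A :: "real set"
    using emeasure_mono[OF that, of lborel] by (auto simp: top_unique)
  have "V x n \<inter> W \<noteq> {}"
  proof
    assume "V x n \<inter> W = {}"
    then have "measure lborel (V x n \<union> W) = measure lborel (V x n) + measure lborel W"
      using fin sub by (intro measure_Union) auto
    moreover have "measure lborel (V x n \<union> W) \<le> measure lborel {0..3::real}"
      using sub by (intro measure_mono_fmeasurable) (auto simp: fmeasurable_def)
    ultimately show False
      using n mW by simp
  qed
  then obtain v where "\<bar>g (x n + v) - g (x n)\<bar> < \<epsilon> / 2"
      "\<bar>g (x n + v) - g (x n + u n)\<bar> < \<epsilon> / 2"
    by (force simp: V_def W_def algebra_simps)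
  with bad[of n] show False by linarith
qed

text \<open>Passing to z = ln t and subtracting \<open>\<kappa> * z\<close> turns regular variation
  into the additive setting with limit 0. The removed factor (t'/t)^\<kappa> is itself close to 1
  when t'/t is, so a short range of multipliers gives a plain comparison of \<open>f t'\<close> with
  \<open>f t\<close>.\<close>

lemma regularly_varying_uniform:
  assumes f: "regularly_varying_at_infinity f \<kappa>" and "\<epsilon> > 0"
  shows "\<exists>\<delta>>0. \<forall>\<^sub>F t in at_top. \<forall>t'\<in>{t..(1 + \<delta>) * t}. \<bar>f t' / f t - 1\<bar> < \<epsilon>"
proof -
  from f obtain a where pos: "\<And>t. t > a \<Longrightarrow> f t > 0"
      and meas: "f \<in> borel_measurable (restrict_space borel {a<..})"
      and lim: "\<And>x. x > 0 \<Longrightarrow> ((\<lambda>t. f (t * x) / f t) \<longlongrightarrow> x powr \<kappa>) at_top"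
    by (auto simp: regularly_varying_at_infinity_def)
  \<comment> \<open>Overwriting \<open>f\<close> by 1 up to a makes it positive and Borel on the
    whole line without affecting limits at infinity.\<close>
  define f' where "f' t = (if t > a then f t else 1)" for t
  have f'pos: "f' t > 0" for t
    using pos by (simp add: f'_def)
  have [measurable]: "f' \<in> borel_measurable borel"
    unfolding f'_def using meas
    by (subst measurable_If_restrict_space_iff) (auto simp: greaterThan_def)
  have ev_f': "\<forall>\<^sub>F t in at_top. f' (t * x) / f' t = f (t * x) / f t" if "x > 0" for x
  proof -
    have "\<forall>\<^sub>F t in at_top. t > a" "\<forall>\<^sub>F t in at_top. t > a / x"
      by (rule eventually_gt_at_top)+
    then show ?thesis
      by eventually_elim (use that in \<open>auto simp: f'_def field_simps\<close>)
  qed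
  define g where "g z = ln (f' (exp z)) - \<kappa> * z" for z
  have "((\<lambda>z. g (z + u) - g z) \<longlongrightarrow> 0) at_top" for u
  proof -
    have "((\<lambda>t. f' (t * exp u) / f' t) \<longlongrightarrow> exp u powr \<kappa>) at_top"
      using lim[of "exp u"] ev_f'[of "exp u"] by (simp cong: tendsto_cong)
    from filterlim_compose[OF this exp_at_top]
    have "((\<lambda>z. ln (f' (exp z * exp u) / f' (exp z)) - \<kappa> * u) \<longlongrightarrow> ln (exp u powr \<kappa>) - \<kappa> * u) at_top"
      by (intro tendsto_intros) auto
    moreover have "ln (f' (exp z * exp u) / f' (exp z)) - \<kappa> * u = g (z + u) - g z" for z
      using f'pos[of "exp z"] f'pos[of "exp (z + u)"]
      by (simp add: g_def ln_div exp_add algebra_simps)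
    ultimately show ?thesis by (simp add: ln_powr)
  qed
  moreover have "g \<in> borel_measurable borel"
    unfolding g_def by measurable
  moreover obtain \<eta> where \<eta>: "\<eta> > 0" "\<And>x. \<bar>x\<bar> < \<eta> \<Longrightarrow> \<bar>exp x - 1\<bar> < \<epsilon>"
  proof -
    have "isCont exp (0::real)" by simp
    then show ?thesis
      using that \<open>\<epsilon> > 0\<close> unfolding continuous_at_eps_delta by (auto simp: dist_real_def)
  qed
  ultimately have "\<forall>\<^sub>F z in at_top. \<forall>u\<in>{0..1}. \<bar>g (z + u) - g z\<bar> < \<eta> / 2"
    by (intro slowly_varying_uniform) auto
  from filterlim_iff[THEN iffD1, OF ln_at_top, rule_format, OF this]
  have ev: "\<forall>\<^sub>F t in at_top. \<forall>u\<in>{0..1}. \<bar>g (ln t + u) - g (ln t)\<bar> < \<eta> / 2" .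
  \<comment> \<open>The bound 1 keeps the shift in the interval of uniformity; the other bound
    limits the power term \<open>\<kappa> * u\<close> to \<eta>/2, with the + 1 covering \<kappa> =
    0.\<close>
  define c where "c = min 1 (\<eta> / (2 * (\<bar>\<kappa>\<bar> + 1)))"
  have c: "c > 0" "c \<le> 1" "\<bar>\<kappa>\<bar> * c \<le> \<eta> / 2"
  proof -
    show "c > 0" "c \<le> 1" using \<eta> by (auto simp: c_def)
    have "\<bar>\<kappa>\<bar> * c \<le> (\<bar>\<kappa>\<bar> + 1) * (\<eta> / (2 * (\<bar>\<kappa>\<bar> + 1)))"
      using \<eta> by (intro mult_mono) (auto simp: c_def)
    also have "\<dots> = \<eta> / 2" by (simp add: field_simps)
    finally show "\<bar>\<kappa>\<bar> * c \<le> \<eta> / 2" .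
  qed
  have "\<forall>\<^sub>F t in at_top. \<forall>t'\<in>{t..exp c * t}. \<bar>f t' / f t - 1\<bar> < \<epsilon>"
    using ev eventually_gt_at_top[of a] eventually_gt_at_top[of 0]
  proof eventually_elim
    case (elim t)
    show ?case
    proof
      fix t' assume t': "t' \<in> {t..exp c * t}"
      define u where "u = ln t' - ln t"
      have "t' > 0" "t' > a" using t' elim by auto
      have "ln t' \<le> ln (exp c * t)"
        using t' \<open>t' > 0\<close> elim by (subst ln_le_cancel_iff) auto
      then have u: "u \<in> {0..c}"
        using t' elim \<open>t' > 0\<close> by (auto simp: u_def ln_mult)
      have "\<bar>g (ln t') - g (ln t)\<bar> < \<eta> / 2"
        using elim(1) u c(2) by (auto simp: u_def dest!: bspec[of _ _ u])
      moreover have "\<bar>\<kappa> * u\<bar> \<le> \<eta> / 2"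
        using u c mult_left_mono[of u c "\<bar>\<kappa>\<bar>"] by (auto simp: abs_mult)
      moreover have "ln (f t') - ln (f t) = (g (ln t') - g (ln t)) + \<kappa> * u"
        using elim \<open>t' > 0\<close> \<open>t' > a\<close> by (simp add: g_def f'_def u_def algebra_simps)
      ultimately have "\<bar>exp (ln (f t') - ln (f t)) - 1\<bar> < \<epsilon>"
        by (intro \<eta>(2)) linarith
      then show "\<bar>f t' / f t - 1\<bar> < \<epsilon>"
        using pos[of t] pos[of t'] elim \<open>t' > a\<close> by (simp add: exp_diff)
    qed
  qed
  moreover have "exp c - 1 > 0" using c by simp
  ultimately show ?thesis
    by (intro exI[of _ "exp c - 1"]) auto
qed

section \<open>Limits, integrals and inverses\<close>

lemma scale_bounds:
  fixes s x :: real
  assumes "0 < s" "s < 1 / x" "x \<ge> 1"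
  shows "s < 1" "s * x < 1" "s \<le> s * x"
proof -
  show "s * x < 1" using assms by (simp add: field_simps)
  show "s \<le> s * x" using assms by simp
  then show "s < 1" using \<open>s * x < 1\<close> by linarith
qed

lemma eventually_at_right_0: "\<forall>\<^sub>F s in at_right (0::real). 0 < s \<and> s < c" if "c > 0"
  using eventually_at_right_real[OF that] by eventually_elim auto

lemma filterlim_mult_at_right_0: "filterlim (\<lambda>s. s * z) (at_right 0) (at_right 0)" if "z > 0" for z :: real
proof -
  have "filterlim (\<lambda>s. s * z) (nhds 0) (at_right 0)"
    by (rule tendsto_eq_intros | simp)+
  moreover have "\<forall>\<^sub>F s in at_right 0. s * z \<in> {0<..}"
    using eventually_at_right_0[OF zero_less_one] by eventually_elim (use that in auto)
  ultimately show ?thesis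
    by (simp add: filterlim_at eventually_conj_iff) (auto elim: eventually_mono)
qed

text \<open>The comparison integrand for \<open>\<phi>'\<close>: where \<open>q\<close> is nearly a
  constant Q, the derivative - \<open>q t\<close> / t lies between two multiples of 1/t.\<close>

lemma integral_inverse:
  fixes a b c :: real
  assumes "0 < a" "a \<le> b"
  shows "set_integrable lborel {a..b} (\<lambda>t. c / t)" "(LINT t:{a..b}|lborel. c / t) = c * ln (b / a)"
proof -
  have c: "continuous_on {a..b} (\<lambda>t. c / t)"
    using assms by (auto intro!: continuous_intros)
  show "set_integrable lborel {a..b} (\<lambda>t. c / t)"
    by (rule borel_integrable_atLeastAtMost'[OF c])
  have "(LINT t:{a..b}|lborel. c / t) = c * ln b - c * ln a"
    unfolding set_lebesgue_integral_def
    using assms c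
    by (intro integral_FTC_atLeastAtMost)
       (auto intro!: derivative_eq_intros simp: has_real_derivative_iff_has_vector_derivative[symmetric])
  then show "(LINT t:{a..b}|lborel. c / t) = c * ln (b / a)"
    using assms by (simp add: ln_div algebra_simps)
qed

lemma ennreal_inverse_less:
  fixes y z :: ennreal
  assumes "y < z"
  shows "inverse z < inverse y"
proof (cases "y = 0 \<or> z = top")
  case True
  then show ?thesis
    using assms by (auto simp: ennreal_inverse_positive less_top[symmetric])
next
  case False
  then show ?thesis
    using assms by (cases y; cases z) (auto simp: inverse_ennreal ennreal_less_iff less_le top_unique)
qed

lemma ennreal_inverse_inverse: "inverse (inverse x) = (x :: ennreal)"
proof (cases "x = 0 \<or> x = top")
  case False
  then show ?thesis
    by (cases x) (auto simp: inverse_ennreal zero_less_iff_neq_zero)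
qed auto

text \<open>A bound c is either a value h(w), and then w separates by strict monotonicity, or lies
  outside the interval [a,b] of all values and holds trivially. This yields continuity of
  \<open>chi\<close> on [0,\<infinity>] from order properties alone.\<close>

lemma strict_mono_surj_continuous:
  fixes h :: "'a::linorder_topology \<Rightarrow> 'b::linorder_topology"
  assumes h: "strict_mono h" and r: "range h = {a..b}"
  shows "continuous_on UNIV h"
proof -
  have "(h \<longlongrightarrow> h x) (at x)" for x
  proof (rule order_tendstoI)
    fix c assume c: "c < h x"
    show "\<forall>\<^sub>F z in at x. c < h z"
    proof (cases "c \<in> range h")
      case True
      then obtain w where w: "c = h w" by auto
      then have "w < x" using c h by (simp add: strict_mono_less)
      then have "\<forall>\<^sub>F z in at x. w < z"
        by (auto intro: order_tendstoD(1)[OF tendsto_ident_at])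
      then show ?thesis by eventually_elim (use w h in \<open>simp add: strict_mono_less\<close>)
    next
      case False
      moreover have "h x \<in> {a..b}" using r by blast
      ultimately have "c < a" using c r by (auto simp: not_le)
      moreover have "h z \<in> {a..b}" for z using r by blast
      ultimately show ?thesis by (intro always_eventually) (meson atLeastAtMost_iff less_le_trans)
    qed
  next
    fix c assume c: "h x < c"
    show "\<forall>\<^sub>F z in at x. h z < c"
    proof (cases "c \<in> range h")
      case True
      then obtain w where w: "c = h w" by auto
      then have "x < w" using c h by (simp add: strict_mono_less)
      then have "\<forall>\<^sub>F z in at x. z < w"
        by (auto intro: order_tendstoD(2)[OF tendsto_ident_at])
      then show ?thesis by eventually_elim (use w h in \<open>simp add: strict_mono_less\<close>)
    next
      case False
      moreover have "h x \<in> {a..b}" using r by blast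
      ultimately have "b < c" using c r by (auto simp: not_le)
      moreover have "h z \<in> {a..b}" for z using r by blast
      ultimately show ?thesis by (intro always_eventually) (meson atLeastAtMost_iff le_less_trans)
    qed
  qed
  then show ?thesis by (auto simp: continuous_on_def)
qed

section \<open>Slowly varying generators\<close>

text \<open>Uniformity of the first margin of the copula is \<open>gen_inverse_gen\<close>.\<close>

locale slow_generator =
  fixes \<phi> :: "real \<Rightarrow> ennreal" and \<phi>' :: "real \<Rightarrow> real" and \<kappa> :: real
  assumes generator: "archimedean_generator \<phi>"
    and gen_inverse_gen: "u \<in> {0..1} \<Longrightarrow> gen_inverse \<phi> (\<phi> u) = u"
    and derivative: "generator_derivative \<phi> \<phi>'"
    and gen_0: "\<phi> 0 = \<infinity>"
    and elasticity: "((\<lambda>s. s * \<phi>' s / enn2real (\<phi> s)) \<longlongrightarrow> 0) (at_right 0)"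
    and psi_rv: "regularly_varying_at_infinity (psi \<phi> \<phi>') \<kappa>"
begin

section \<open>Strict monotonicity and finiteness of the generator\<close>

abbreviation P :: "ennreal \<Rightarrow> real" where "P \<equiv> gen_inverse \<phi>"

text \<open>At 0 the conversion from infinity returns the default \<open>f 0 = 0\<close>, which
  breaks monotonicity; hence the condition that arguments be positive in what follows.\<close>

definition f :: "real \<Rightarrow> real" where "f s = enn2real (\<phi> s)"

definition q :: "real \<Rightarrow> real" where "q s = - s * \<phi>' s"

lemma gen_1: "\<phi> 1 = 0"
  using generator by (simp add: archimedean_generator_def)

text \<open>The left inverse \<open>P\<close> makes \<open>\<phi>\<close> injective on [0,1], which
  upgrades weak to strict decrease.\<close>

lemma gen_strict: "\<phi> b < \<phi> a" if "0 \<le> a" "a < b" "b \<le> 1"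
proof -
  have "antimono_on {0..1} \<phi>"
    using generator by (simp add: archimedean_generator_def)
  then have "\<phi> b \<le> \<phi> a"
    using that by (auto simp: monotone_on_def)
  moreover have "\<phi> b \<noteq> \<phi> a"
    using gen_inverse_gen[of a] gen_inverse_gen[of b] that by auto
  ultimately show ?thesis by simp
qed

lemma gen_less_iff: "\<phi> b < \<phi> a \<longleftrightarrow> a < b" if "a \<in> {0..1}" "b \<in> {0..1}"
  using gen_strict[of a b] gen_strict[of b a] that by (cases a b rule: linorder_cases) auto

lemma gen_eq: "\<phi> u = ennreal (f u)" if "0 < u" "u \<le> 1"
  using gen_strict[of 0 u] that gen_0 by (simp add: f_def)

lemma f_nonneg: "f u \<ge> 0"
  by (simp add: f_def)

lemma f_1: "f 1 = 0"
  by (simp add: f_def gen_1)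

lemma f_strict: "f b < f a" if "0 < a" "a < b" "b \<le> 1"
proof -
  have "ennreal (f b) < ennreal (f a)"
    using gen_strict[of a b] gen_eq[of a] gen_eq[of b] that by simp
  then show ?thesis
    using f_nonneg[of b] by (simp add: ennreal_less_iff)
qed

lemma f_mono: "f b \<le> f a" if "0 < a" "a \<le> b" "b \<le> 1"
  using f_strict[of a b] that by (cases "a = b") auto

lemma f_pos: "f a > 0" if "0 < a" "a < 1"
  using f_strict[of a 1] that f_1 by simp

section \<open>Convexity through the monotone derivative\<close>

lemma derivative_integrable: "set_integrable lborel {a..b} \<phi>'" if "0 < a" "a \<le> b" "b \<le> 1"
  using derivative that by (auto simp: generator_derivative_def)

lemma f_integral: "f b - f a = (LINT t:{a..b}|lborel. \<phi>' t)" if "0 < a" "a \<le> b" "b \<le> 1"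
  using derivative that by (auto simp: generator_derivative_def f_def)

lemma derivative_mono: "\<phi>' a \<le> \<phi>' b" if "0 < a" "a \<le> b" "b < 1"
  using derivative that by (auto simp: generator_derivative_def monotone_on_def)

text \<open>This is the tangent bound at the left endpoint: on the interval the slope is at least
  \<open>\<phi>' a\<close>, so the drop of \<open>f\<close> is at most that of the tangent
  line.\<close>

lemma f_diff_le: "f a - f b \<le> (b - a) * (- \<phi>' a)" if "0 < a" "a \<le> b" "b \<le> 1" "a < 1"
proof -
  have "(LINT t:{a..b}|lborel. \<phi>' a) \<le> (LINT t:{a..b}|lborel. \<phi>' t)"
    unfolding set_lebesgue_integral_def
  proof (rule integral_mono_AE)
    show "integrable lborel (\<lambda>x. indicat_real {a..b} x *\<^sub>R \<phi>' a)"
      using that by (intro integrable_scaleR_left integrable_real_indicator) auto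
    show "integrable lborel (\<lambda>x. indicat_real {a..b} x *\<^sub>R \<phi>' x)"
      using derivative_integrable[of a b] that by (simp add: set_integrable_def)
    \<comment> \<open>Monotonicity of \<open>\<phi>'\<close> is known on the open unit interval and
      its value at 1 is arbitrary, so the point 1 is discarded as a null set.\<close>
    show "AE x in lborel. indicat_real {a..b} x *\<^sub>R \<phi>' a \<le> indicat_real {a..b} x *\<^sub>R \<phi>' x"
      using AE_lborel_singleton[of 1]
      by eventually_elim (use that derivative_mono in \<open>auto simp: indicator_def\<close>)
  qed
  moreover have "(LINT t:{a..b}|lborel. \<phi>' a) = (b - a) * \<phi>' a"
    using that by (simp add: set_lebesgue_integral_def)
  ultimately show ?thesis
    using f_integral[of a b] that by (simp add: algebra_simps)
qed

lemma derivative_neg: "\<phi>' a < 0" if "0 < a" "a < 1"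
proof -
  have "0 < (1 - a) * (- \<phi>' a)"
    using f_diff_le[of a 1] f_pos[of a] f_1 that by simp
  then show ?thesis
    using that by (simp add: mult_less_0_iff)
qed

lemma q_pos: "q s > 0" if "0 < s" "s < 1"
  using derivative_neg[of s] that by (simp add: q_def mult_less_0_iff)

text \<open>The graph is steepest at the left end, so \<open>- \<phi>' a\<close> is a Lipschitz
  constant on all of [a,1].\<close>

lemma continuous_on_f: "continuous_on {a..1} f" if "0 < a" "a < 1"
proof (rule lipschitz_on_continuous_on)
  show "(- \<phi>' a)-lipschitz_on {a..1} f"
  proof (rule lipschitz_onI)
    have *: "\<bar>f x - f y\<bar> \<le> (- \<phi>' a) * \<bar>x - y\<bar>" if "a \<le> x" "x < y" "y \<le> 1" for x y
    proof -
      have "f x - f y \<le> (y - x) * (- \<phi>' x)"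
        using that \<open>0 < a\<close> by (intro f_diff_le) auto
      also have "\<dots> \<le> (y - x) * (- \<phi>' a)"
        using that \<open>0 < a\<close> derivative_mono[of a x] by (intro mult_left_mono) auto
      finally show ?thesis
        using f_mono[of x y] that \<open>0 < a\<close> by (simp add: mult.commute)
    qed
    fix x y assume "x \<in> {a..1}" "y \<in> {a..1}"
    then show "dist (f x) (f y) \<le> (- \<phi>' a) * dist x y"
      using *[of x y] *[of y x]
      by (cases x y rule: linorder_cases) (auto simp: dist_real_def abs_minus_commute)
  qed (use derivative_neg[of a] that in auto)
qed

section \<open>Growth at 0 and the two-sided inverse\<close>

text \<open>If \<open>\<phi>\<close> were bounded near 0, then \<open>psi\<close> would vanish eventually, as \<open>gen_inverse \<phi>\<close> does.\<close>

lemma f_unbounded: "\<exists>u\<in>{0<..<1}. f u > T"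
\<comment> \<open>The value infinity at 0 alone does not exclude a finite limit from the right;
  positivity of \<open>psi\<close> far out does.\<close>
proof (rule ccontr)
  assume "\<not> ?thesis"
  then have le: "f u \<le> T" if "0 < u" "u < 1" for u
    using that by (meson not_le greaterThanLessThan_iff)
  have P0: "P (ennreal t) = 0" if "t \<ge> T" for t
  proof -
    have "P (ennreal t) \<le> u" if "0 < u" "u < 1" for u
      unfolding gen_inverse_def
    proof (rule cInf_lower)
      show "u \<in> {t' \<in> {0..1}. \<phi> t' \<le> ennreal t}"
        using le[of u] \<open>T \<le> t\<close> gen_eq[of u] that by (auto intro: ennreal_leI)
    qed (auto intro!: bdd_belowI[of _ 0])
    then have "P (ennreal t) \<le> 0"
      by (intro dense_ge_bounded[of 0 1]) auto
    moreover have "P (ennreal t) \<ge> 0"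
      unfolding gen_inverse_def by (rule cInf_greatest) (auto intro!: exI[of _ 1] simp: gen_1)
    ultimately show ?thesis by simp
  qed
  from psi_rv obtain a where "\<forall>t>a. psi \<phi> \<phi>' t > 0"
    by (auto simp: regularly_varying_at_infinity_def)
  then have "psi \<phi> \<phi>' (max T (a + 1)) > 0" by simp
  then show False
    using P0[of "max T (a + 1)"] by (simp add: psi_eq)
qed

lemma f_at_top: "filterlim f at_top (at_right 0)"
  unfolding filterlim_at_top
proof
  fix Z
  obtain u where u: "0 < u" "u < 1" "f u > Z"
    using f_unbounded[of Z] by auto
  have "\<forall>\<^sub>F s in at_right 0. s \<in> {0<..<u}"
    using u by (intro eventually_at_right_real)
  then show "\<forall>\<^sub>F s in at_right 0. Z \<le> f s"
    by eventually_elim (use u f_mono[of _ u] in fastforce)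
qed

text \<open>Finite levels are reached by the intermediate value theorem, infinity at the point 0.
  Surjectivity turns the left inverse \<open>P\<close> into a two-sided one.\<close>

lemma gen_surj: "\<exists>u\<in>{0..1}. \<phi> u = y"
proof (cases y)
  case (real t)
  obtain u where u: "0 < u" "u < 1" "f u > t"
    using f_unbounded[of t] by auto
  then obtain v where "u \<le> v" "v \<le> 1" "f v = t"
    using IVT2'[of f 1 t u] continuous_on_f[of u] f_1 real by auto
  then show ?thesis
    using gen_eq[of v] u real by (intro bexI[of _ v]) auto
qed (use gen_0 in auto)

lemma P_range: "P y \<in> {0..1}" and gen_P: "\<phi> (P y) = y"
  using gen_surj[of y] gen_inverse_gen by force+

lemma P_less_iff: "P y < P z \<longleftrightarrow> z < y"
  using gen_less_iff[OF P_range[of y] P_range[of z]] by (simp add: gen_P)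

lemma P_le_iff: "P y \<le> P z \<longleftrightarrow> z \<le> y"
  using P_less_iff[of z y] by (simp add: not_less [symmetric])

lemma P_f: "P (ennreal (f u)) = u" if "0 < u" "u \<le> 1"
  using gen_inverse_gen[of u] gen_eq[of u] that by simp

lemma P_pos: "P (ennreal t) > 0"
proof -
  have "P (ennreal t) \<noteq> 0"
    using gen_P[of "ennreal t"] gen_0 by auto
  then show ?thesis
    using P_range[of "ennreal t"] by auto
qed

lemma P_less_1: "P (ennreal t) < 1" if "t > 0"
proof -
  have "P (ennreal t) \<noteq> 1"
    using gen_P[of "ennreal t"] gen_1 that by auto
  then show ?thesis
    using P_range[of "ennreal t"] by auto
qed

lemma f_P: "f (P (ennreal t)) = t" if "t \<ge> 0"
  using that by (simp add: f_def gen_P)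

lemma psi_f: "psi \<phi> \<phi>' (f s) = q s" if "0 < s" "s \<le> 1"
  using that by (simp add: psi_eq P_f q_def)

lemma chi_eq: "chi \<phi> \<phi>' s y = P (inverse y * ennreal (q s))" if "0 < s" "s \<le> 1"
  using that psi_f[of s] by (simp add: chi_def f_def)

section \<open>Asymptotics of the generator near 0\<close>

lemma q_over_f: "((\<lambda>s. q s / f s) \<longlongrightarrow> 0) (at_right 0)"
  using tendsto_minus[OF elasticity] by (simp add: q_def f_def)

text \<open>The tangent bound at s limits the drop from s to \<open>s * x\<close> to
  \<open>(x - 1) * q s\<close>, which is negligible against \<open>f s\<close>.\<close>

lemma f_slowly_varying: "((\<lambda>s. f (s * x) / f s) \<longlongrightarrow> 1) (at_right 0)" if "x \<ge> 1"
proof (rule tendsto_sandwich)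
  have ev: "\<forall>\<^sub>F s in at_right 0. 0 < s \<and> s < 1 / x"
    using that by (intro eventually_at_right_0) auto
  show "\<forall>\<^sub>F s in at_right 0. 1 - (x - 1) * (q s / f s) \<le> f (s * x) / f s"
    using ev
  proof eventually_elim
    case (elim s)
    then have s: "0 < s" "s < 1" "s * x < 1" "s \<le> s * x"
      using scale_bounds[of s x] that by blast+
    have "f s - f (s * x) \<le> (s * x - s) * (- \<phi>' s)"
      by (intro f_diff_le) (use s in linarith)+
    also have "\<dots> = (x - 1) * q s"
      by (simp add: q_def algebra_simps)
    finally have "(f s - (x - 1) * q s) / f s \<le> f (s * x) / f s"
      by (intro divide_right_mono) (simp_all add: f_nonneg)
    then show ?case
      using f_pos[OF s(1,2)] by (simp add: diff_divide_distrib)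
  qed
  show "\<forall>\<^sub>F s in at_right 0. f (s * x) / f s \<le> 1"
    using ev
  proof eventually_elim
    case (elim s)
    then have s: "0 < s" "s < 1" "s * x < 1" "s \<le> s * x"
      using scale_bounds[of s x] that by blast+
    then show ?case
      using f_mono[of s "s * x"] f_pos[OF s(1,2)] by simp
  qed
  show "((\<lambda>s. 1 - (x - 1) * (q s / f s)) \<longlongrightarrow> 1) (at_right 0)"
    using tendsto_diff[OF tendsto_const tendsto_mult_left[OF q_over_f, of "x - 1"], of 1] by simp
qed auto

text \<open>As u runs through the interval, \<open>f u\<close> stays between
  \<open>f (s * x)\<close> and \<open>f s\<close>, whose ratio tends to 1, so all values fall in one
  short window for \<open>psi\<close>. The comparison point is the right end because
  \<open>f\<close> is smallest there and the window of \<open>regularly_varying_uniform\<close>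
  extends upwards.\<close>

lemma q_uniform:
  assumes "x \<ge> 1" "\<epsilon> > 0"
  shows "\<forall>\<^sub>F s in at_right 0. \<forall>u\<in>{s..s * x}. \<bar>q u / q (s * x) - 1\<bar> < \<epsilon>"
proof -
  obtain \<delta> where \<delta>: "\<delta> > 0"
    and ev: "\<forall>\<^sub>F t in at_top. \<forall>t'\<in>{t..(1 + \<delta>) * t}. \<bar>psi \<phi> \<phi>' t' / psi \<phi> \<phi>' t - 1\<bar> < \<epsilon>"
    using regularly_varying_uniform[OF psi_rv \<open>\<epsilon> > 0\<close>] by blast
  have "filterlim (\<lambda>s. f (s * x)) at_top (at_right 0)"
    using assms by (intro filterlim_compose[OF f_at_top] filterlim_mult_at_right_0) auto
  from filterlim_iff[THEN iffD1, OF this, rule_format, OF ev]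
  have ev': "\<forall>\<^sub>F s in at_right 0. \<forall>t'\<in>{f (s * x)..(1 + \<delta>) * f (s * x)}.
      \<bar>psi \<phi> \<phi>' t' / psi \<phi> \<phi>' (f (s * x)) - 1\<bar> < \<epsilon>" .
  have "\<forall>\<^sub>F s in at_right 0. f (s * x) / f s > 1 / (1 + \<delta>)"
    using f_slowly_varying[OF \<open>x \<ge> 1\<close>] \<delta> by (intro order_tendstoD(1)) (auto simp: field_simps)
  moreover have "\<forall>\<^sub>F s in at_right 0. 0 < s \<and> s < 1 / x"
    using assms by (intro eventually_at_right_0) auto
  ultimately show ?thesis
    using ev'
  proof eventually_elim
    case (elim s)
    then have s: "0 < s" "s < 1" "s * x < 1" "s \<le> s * x"
      using scale_bounds[of s x] assms by blast+
    show ?case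
    proof
      fix u assume u: "u \<in> {s..s * x}"
      have "f u \<le> f s" "f (s * x) \<le> f u"
        using u s by (auto intro!: f_mono)
      moreover have "f s < (1 + \<delta>) * f (s * x)"
        using elim(1) \<delta> f_pos[OF s(1,2)] s by (simp add: field_simps)
      ultimately have "\<bar>psi \<phi> \<phi>' (f u) / psi \<phi> \<phi>' (f (s * x)) - 1\<bar> < \<epsilon>"
        using elim(3) by auto
      then show "\<bar>q u / q (s * x) - 1\<bar> < \<epsilon>"
        using u s by (simp add: psi_f)
    qed
  qed
qed

text \<open>The normaliser is the reference value of \<open>q_uniform\<close>: on the interval
  \<open>\<phi>' t\<close> is within a factor 1 \<plusminus> \<epsilon> of
  \<open>- q (s * x) / t\<close>, and 1/t integrates to \<open>ln x\<close>.\<close>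

lemma f_diff_right:
  assumes "x \<ge> 1"
  shows "((\<lambda>s. (f s - f (s * x)) / q (s * x)) \<longlongrightarrow> ln x) (at_right 0)"
proof (rule tendstoI)
  fix e :: real assume "e > 0"
  \<comment> \<open>Adding 1 keeps the denominator positive at x = 1 and makes the final inequality
    strict.\<close>
  define \<epsilon> where "\<epsilon> = e / (ln x + 1)"
  have lnx: "ln x \<ge> 0" using assms by simp
  have "\<epsilon> > 0" "\<epsilon> * ln x < e"
    using \<open>e > 0\<close> lnx by (auto simp: \<epsilon>_def field_simps)
  have "\<forall>\<^sub>F s in at_right 0. 0 < s \<and> s < 1 / x"
    using assms by (intro eventually_at_right_0) auto
  with q_uniform[OF assms \<open>\<epsilon> > 0\<close>]
  show "\<forall>\<^sub>F s in at_right 0. dist ((f s - f (s * x)) / q (s * x)) (ln x) < e"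
  proof eventually_elim
    case (elim s)
    then have s: "0 < s" "s < 1" "s * x < 1" "s \<le> s * x"
      using scale_bounds[of s x] assms by blast+
    define Q where "Q = q (s * x)"
    have "Q > 0" using q_pos[of "s * x"] s by (simp add: Q_def)
    have int: "set_integrable lborel {s..s * x} \<phi>'"
      using s by (intro derivative_integrable) auto
    have bound: "- (1 + \<epsilon>) * Q / t \<le> \<phi>' t \<and> \<phi>' t \<le> - (1 - \<epsilon>) * Q / t" if "t \<in> {s..s * x}" for t
    proof -
      have "\<bar>q t / Q - 1\<bar> < \<epsilon>" using elim that by (auto simp: Q_def)
      then have "\<bar>q t - Q\<bar> < \<epsilon> * Q"
        using \<open>Q > 0\<close> by (simp add: field_simps abs_less_iff)
      then show ?thesis
        using that s \<open>Q > 0\<close> by (auto simp: q_def field_simps abs_less_iff)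
    qed
    have ln_eq: "ln (s * x / s) = ln x" using s by simp
    have "- (1 + \<epsilon>) * Q * ln x \<le> (LINT t:{s..s * x}|lborel. \<phi>' t)"
      using set_integral_mono[OF integral_inverse(1)[of s "s * x" "- (1 + \<epsilon>) * Q"] int] bound s
      by (auto simp: integral_inverse(2) ln_eq)
    moreover have "(LINT t:{s..s * x}|lborel. \<phi>' t) \<le> - (1 - \<epsilon>) * Q * ln x"
      using set_integral_mono[OF int integral_inverse(1)[of s "s * x" "- (1 - \<epsilon>) * Q"]] bound s
      by (auto simp: integral_inverse(2) ln_eq)
    ultimately have "(1 - \<epsilon>) * Q * ln x \<le> f s - f (s * x)" "f s - f (s * x) \<le> (1 + \<epsilon>) * Q * ln x"
      using f_integral[of s "s * x"] s by (auto simp: algebra_simps)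
    then have "\<bar>(f s - f (s * x)) / Q - ln x\<bar> \<le> \<epsilon> * ln x"
      using \<open>Q > 0\<close> by (simp add: field_simps abs_le_iff)
    then show ?case
      using \<open>\<epsilon> * ln x < e\<close> by (simp add: dist_real_def Q_def)
  qed
qed

lemma q_ratio:
  assumes "x \<ge> 1"
  shows "((\<lambda>s. q s / q (s * x)) \<longlongrightarrow> 1) (at_right 0)"
proof (rule tendstoI)
  fix e :: real assume "e > 0"
  from q_uniform[OF assms this] eventually_at_right_0[OF zero_less_one]
  show "\<forall>\<^sub>F s in at_right 0. dist (q s / q (s * x)) 1 < e"
    by eventually_elim (use assms in \<open>auto simp: dist_real_def dest!: bspec\<close>)
qed

lemma f_diff:
  assumes "x > 0"
  shows "((\<lambda>s. (f (s * x) - f s) / q s) \<longlongrightarrow> - ln x) (at_right 0)"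
proof (cases "x \<ge> 1")
  case True
  have "((\<lambda>s. - (((f s - f (s * x)) / q (s * x)) / (q s / q (s * x)))) \<longlongrightarrow> - (ln x / 1)) (at_right 0)"
    by (intro tendsto_intros f_diff_right[OF True] q_ratio[OF True]) auto
  moreover have "\<forall>\<^sub>F s in at_right 0. - (((f s - f (s * x)) / q (s * x)) / (q s / q (s * x)))
      = (f (s * x) - f s) / q s"
  proof -
    have "\<forall>\<^sub>F s in at_right 0. 0 < s \<and> s < 1 / x"
      using assms by (intro eventually_at_right_0) auto
    then show ?thesis
    proof eventually_elim
      case (elim s)
      then have "q (s * x) > 0"
        using assms by (intro q_pos) (auto simp: field_simps)
      then show ?case by (simp add: minus_divide_left)
    qed
  qed
  ultimately show ?thesis
    unfolding div_by_1 by (rule Lim_transform_eventually)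
next
  case False
  \<comment> \<open>For x < 1 the roles of the endpoints are exchanged: with base point
    \<open>s * x\<close> and multiplier 1/x the right endpoint is s, so the normaliser is already
    \<open>q s\<close>.\<close>
  then have "1 / x \<ge> 1" using assms by simp
  from filterlim_compose[OF f_diff_right[OF this] filterlim_mult_at_right_0[OF assms]]
  show ?thesis using assms by (simp add: ln_div)
qed

text \<open>Inverting \<open>f_diff\<close> at the point \<open>P (k * f s)\<close>.\<close>

lemma P_limit:
  assumes "k \<ge> 1" and v: "(v \<longlongrightarrow> v0) (at_right 0)"
  shows "((\<lambda>s. P (ennreal (k * f s + v s * q s)) / P (ennreal (k * f s))) \<longlongrightarrow>
    exp (- (v0 * k powr (- \<kappa>)))) (at_right 0)"
proof -
  define \<sigma> where "\<sigma> s = P (ennreal (k * f s))" for s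
  define c where "c = v0 * k powr (- \<kappa>)"
  have ev01: "\<forall>\<^sub>F s in at_right 0. 0 < s \<and> s < (1::real)"
    by (rule eventually_at_right_0) simp
  have \<sigma>_pos: "\<sigma> s > 0" for s
    by (simp add: \<sigma>_def P_pos)
  have \<sigma>_less: "\<sigma> s < 1" if "0 < s" "s < 1" for s
    unfolding \<sigma>_def using f_pos[OF that] assms by (intro P_less_1) auto
  have f_\<sigma>: "f (\<sigma> s) = k * f s" for s
    unfolding \<sigma>_def using f_nonneg[of s] assms by (intro f_P) auto
  have \<sigma>_lim: "filterlim \<sigma> (at_right 0) (at_right 0)"
  proof -
    have "(\<sigma> \<longlongrightarrow> 0) (at_right 0)"
    proof (rule tendsto_sandwich[of "\<lambda>_. 0"])
      show "\<forall>\<^sub>F s in at_right 0. \<sigma> s \<le> s"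
        using ev01
      proof eventually_elim
        case (elim s)
        have "f s \<le> k * f s"
          using f_nonneg[of s] assms mult_right_mono[of 1 k "f s"] by simp
        then have "\<sigma> s \<le> P (ennreal (f s))"
          by (simp add: \<sigma>_def P_le_iff ennreal_leI)
        then show ?case using elim by (simp add: P_f)
      qed
    qed (use \<sigma>_pos in \<open>auto intro!: always_eventually less_imp_le\<close>)
    then show ?thesis
      using \<sigma>_pos by (simp add: filterlim_at less_imp_neq[symmetric])
  qed
  have "((\<lambda>s. psi \<phi> \<phi>' (f s * k) / psi \<phi> \<phi>' (f s)) \<longlongrightarrow> k powr \<kappa>) (at_right 0)"
    using psi_rv assms
    by (intro filterlim_compose[OF _ f_at_top]) (auto simp: regularly_varying_at_infinity_def)
  moreover have "\<forall>\<^sub>F s in at_right 0. psi \<phi> \<phi>' (f s * k) / psi \<phi> \<phi>' (f s) = q (\<sigma> s) / q s"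
    using ev01
    by eventually_elim (use psi_f psi_f[of "\<sigma> _"] \<sigma>_pos \<sigma>_less in \<open>auto simp: f_\<sigma> mult.commute less_imp_le\<close>)
  ultimately have q\<sigma>: "((\<lambda>s. q (\<sigma> s) / q s) \<longlongrightarrow> k powr \<kappa>) (at_right 0)"
    by (simp cong: tendsto_cong)
  \<comment> \<open>The perturbation is re-expressed in the unit \<open>q (\<sigma> s)\<close>
    belonging to the point where the inversion takes place; this change of unit produces the factor
    k^(-\<kappa>).\<close>
  define v' where "v' s = v s / (q (\<sigma> s) / q s)" for s
  have v': "(v' \<longlongrightarrow> c) (at_right 0)"
    unfolding v'_def c_def powr_minus divide_inverse[symmetric]
    using assms by (intro tendsto_divide v q\<sigma>) auto
  have v'_eq: "v s * q s = v' s * q (\<sigma> s)" if "0 < s" "s < 1" for s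
    using q_pos[OF that] q_pos[OF \<sigma>_pos \<sigma>_less[OF that]] by (simp add: v'_def)
  have ev_small: "\<forall>\<^sub>F s in at_right 0. 0 < s \<and> s < 1 \<and> \<sigma> s * z < 1" if "z > 0" for z
  proof -
    have "\<forall>\<^sub>F s in at_right 0. 0 < \<sigma> s \<and> \<sigma> s < 1 / z"
      using filterlim_iff[THEN iffD1, OF \<sigma>_lim, rule_format, OF eventually_at_right_0[of "1 / z"]] that
      by simp
    with ev01 show ?thesis
      by eventually_elim (use that in \<open>auto simp: field_simps\<close>)
  qed
  \<comment> \<open>Since \<open>f (\<sigma> s)\<close> = \<open>k * f s\<close>, the sign of this
    difference tells on which side of \<open>f (\<sigma> s * z)\<close> the perturbed argument lies.
    The limit changes sign at z = exp(-c), the value to be identified.\<close>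
  have diff: "((\<lambda>s. v' s - (f (\<sigma> s * z) - f (\<sigma> s)) / q (\<sigma> s)) \<longlongrightarrow> c + ln z) (at_right 0)"
    if "z > 0" for z
    using tendsto_diff[OF v' filterlim_compose[OF f_diff[OF that] \<sigma>_lim]] by simp
  have lower: "\<forall>\<^sub>F s in at_right 0. z \<le> P (ennreal (k * f s + v s * q s)) / \<sigma> s"
    if z: "z > 0" "z < exp (- c)" for z
  proof -
    have "c + ln z < 0"
      using z ln_less_cancel_iff[of z "exp (- c)"] by simp
    from order_tendstoD(2)[OF diff[OF z(1)] this] ev_small[OF z(1)]
    show ?thesis
    proof eventually_elim
      case (elim s)
      have q: "q (\<sigma> s) > 0" using elim q_pos \<sigma>_pos \<sigma>_less by auto
      have "k * f s + v s * q s < f (\<sigma> s * z)"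
        using elim q by (simp add: v'_eq f_\<sigma> field_simps)
      then have "P (ennreal (f (\<sigma> s * z))) \<le> P (ennreal (k * f s + v s * q s))"
        by (simp add: P_le_iff ennreal_leI)
      then have "\<sigma> s * z \<le> P (ennreal (k * f s + v s * q s))"
        using P_f[of "\<sigma> s * z"] elim \<sigma>_pos[of s] z by simp
      then show ?case
        using \<sigma>_pos[of s] by (simp add: field_simps)
    qed
  qed
  have upper: "\<forall>\<^sub>F s in at_right 0. P (ennreal (k * f s + v s * q s)) / \<sigma> s \<le> z"
    if z: "z > exp (- c)" for z
  proof -
    have "z > 0" using z exp_gt_zero[of "- c"] by linarith
    then have "c + ln z > 0"
      using z ln_less_cancel_iff[of "exp (- c)" z] by simp
    from order_tendstoD(1)[OF diff[OF \<open>z > 0\<close>] this] ev_small[OF \<open>z > 0\<close>]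
    show ?thesis
    proof eventually_elim
      case (elim s)
      have q: "q (\<sigma> s) > 0" using elim q_pos \<sigma>_pos \<sigma>_less by auto
      have "f (\<sigma> s * z) < k * f s + v s * q s"
        using elim q by (simp add: v'_eq f_\<sigma> field_simps)
      then have "P (ennreal (k * f s + v s * q s)) \<le> P (ennreal (f (\<sigma> s * z)))"
        by (simp add: P_le_iff ennreal_leI)
      then have "P (ennreal (k * f s + v s * q s)) \<le> \<sigma> s * z"
        using P_f[of "\<sigma> s * z"] elim \<sigma>_pos[of s] \<open>z > 0\<close> by simp
      then show ?case
        using \<sigma>_pos[of s] by (simp add: field_simps)
    qed
  qed
  have "((\<lambda>s. P (ennreal (k * f s + v s * q s)) / \<sigma> s) \<longlongrightarrow> exp (- c)) (at_right 0)"
  proof (rule order_tendstoI)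
    fix a assume "a < exp (- c)"
    then obtain z where "max a 0 < z" "z < exp (- c)"
      using dense[of "max a 0" "exp (- c)"] by auto
    with lower[of z] show "\<forall>\<^sub>F s in at_right 0. a < P (ennreal (k * f s + v s * q s)) / \<sigma> s"
      by (auto elim: eventually_mono)
  next
    fix a assume "exp (- c) < a"
    then obtain z where "exp (- c) < z" "z < a"
      using dense by blast
    with upper[of z] show "\<forall>\<^sub>F s in at_right 0. P (ennreal (k * f s + v s * q s)) / \<sigma> s < a"
      by (auto elim: eventually_mono)
  qed
  then show ?thesis by (simp add: \<sigma>_def c_def)
qed

section \<open>The thresholds \<open>chi\<close> and sums of generator values\<close>

lemma chi_strict_mono:
  assumes "0 < s" "s < 1"
  shows "strict_mono (chi \<phi> \<phi>' s)"
proof (rule strict_monoI)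
  fix y z :: ennreal assume "y < z"
  have q: "ennreal (q s) > 0" "ennreal (q s) < \<infinity>"
    using q_pos[of s] assms by auto
  have "inverse z < inverse y"
    using \<open>y < z\<close> by (rule ennreal_inverse_less)
  then have "inverse z * ennreal (q s) < inverse y * ennreal (q s)"
    using q by (intro ennreal_mult_strict_right_mono) auto
  then show "chi \<phi> \<phi>' s y < chi \<phi> \<phi>' s z"
    unfolding chi_eq[OF assms(1) less_imp_le[OF assms(2)]] P_less_iff .
qed

lemma chi_range:
  assumes "0 < s" "s < 1"
  shows "range (chi \<phi> \<phi>' s) = {0..1}"
proof (intro equalityI subsetI)
  fix t :: real assume t: "t \<in> {0..1}"
  have q: "ennreal (q s) > 0" "ennreal (q s) < \<infinity>"
    using q_pos[of s] assms by auto
  have "\<phi> t / ennreal (q s) * ennreal (q s) = \<phi> t"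
    using q mult_divide_eq_ennreal[of "ennreal (q s)" "\<phi> t"] by (simp add: divide_ennreal_def ac_simps)
  \<comment> \<open>The witness solves inverse y * \<open>q s\<close> = \<open>\<phi> t\<close>; the
    conventions for inverses of 0 and infinity make it 0 at t = 0 and infinity at t = 1.\<close>
  then have "chi \<phi> \<phi>' s (inverse (\<phi> t / ennreal (q s))) = t"
    using assms t by (simp add: chi_eq gen_inverse_gen ennreal_inverse_inverse)
  then show "t \<in> range (chi \<phi> \<phi>' s)" by (metis rangeI)
next
  fix t assume "t \<in> range (chi \<phi> \<phi>' s)"
  then show "t \<in> {0..1}"
    using assms by (auto simp only: chi_eq P_range less_imp_le)
qed

lemma chi_homeomorphism:
  assumes "0 < s" "s < 1"
  shows "\<exists>g. homeomorphism UNIV {0..1} (chi \<phi> \<phi>' s) g"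
  using strict_mono_surj_continuous[OF chi_strict_mono[OF assms] chi_range[OF assms]]
    chi_range[OF assms] strict_mono_imp_inj_on[OF chi_strict_mono[OF assms]]
  by (rule homeomorphism_compact[OF compact_UNIV])

text \<open>The threshold exceeds \<open>s * K\<close> eventually for every fixed K \<ge> 1, because
  its generator value \<open>q s / y\<close> is negligible against \<open>f s\<close> while
  \<open>f (s * K)\<close> is asymptotic to \<open>f s\<close>.\<close>

lemma chi_ratio:
  assumes "y > 0"
  shows "((\<lambda>s. s / chi \<phi> \<phi>' s (ennreal y)) \<longlongrightarrow> 0) (at_right 0)"
proof (rule tendstoI)
  fix e :: real assume "e > 0"
  \<comment> \<open>At least 1 as slow variation requires, and at least 2/e so that 1/K is strictly
    below e.\<close>
  define K where "K = max 1 (2 / e)"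
  have K: "K \<ge> 1" "1 / K < e"
    using \<open>e > 0\<close> by (auto simp: K_def max_def field_simps)
  have "((\<lambda>s. f (s * K) / f s - (q s / f s) / y) \<longlongrightarrow> 1 - 0 / y) (at_right 0)"
    by (intro tendsto_intros f_slowly_varying q_over_f) (use K assms in auto)
  then have "\<forall>\<^sub>F s in at_right 0. f (s * K) / f s - (q s / f s) / y > 0"
    by (rule order_tendstoD) simp
  moreover have "\<forall>\<^sub>F s in at_right 0. 0 < s \<and> s < 1 / K"
    using K by (intro eventually_at_right_0) auto
  ultimately show "\<forall>\<^sub>F s in at_right 0. dist (s / chi \<phi> \<phi>' s (ennreal y)) 0 < e"
  proof eventually_elim
    case (elim s)
    then have s: "0 < s" "s < 1" "s * K < 1" "s \<le> s * K"
      using scale_bounds[of s K] K by blast+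
    have "q s / y \<le> f (s * K)"
      using elim(1) f_pos[OF s(1,2)] assms by (simp add: field_simps)
    then have "P (ennreal (f (s * K))) \<le> P (ennreal (q s / y))"
      by (simp add: P_le_iff ennreal_leI)
    moreover have "inverse (ennreal y) * ennreal (q s) = ennreal (q s / y)"
      using assms q_pos[of s] s
      by (simp add: inverse_ennreal ennreal_mult[symmetric] divide_inverse mult.commute)
    ultimately have chi: "s * K \<le> chi \<phi> \<phi>' s (ennreal y)"
      using s K by (simp add: chi_eq[OF s(1) less_imp_le[OF s(2)]] P_f)
    then have "s / chi \<phi> \<phi>' s (ennreal y) \<le> s / (s * K)"
      using s K by (intro divide_left_mono) (auto intro!: mult_pos_pos intro: less_le_trans[of 0 "s * K"])
    also have "\<dots> < e" using s K by simp
    finally show ?case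
      using P_range s(1) by (simp add: dist_real_def chi_def)
  qed
qed

text \<open>Each index in \<open>I\<close> contributes \<open>f s\<close> plus
  \<open>- ln (m i) * q s\<close> up to o(\<open>q s\<close>), and each index in \<open>J\<close>
  exactly \<open>q s / y i\<close>, so the sum has the shape required by \<open>P_limit\<close> with
  k = |I|. Allowing \<open>J\<close> to be empty covers the conditioning event too.\<close>

lemma sum_gen_limit:
  fixes m y :: "nat \<Rightarrow> real"
  assumes I: "finite I" "finite J" "I \<noteq> {}" and m: "\<And>i. i \<in> I \<Longrightarrow> m i > 0"
    and y: "\<And>i. i \<in> J \<Longrightarrow> y i > 0"
  shows "((\<lambda>s. P ((\<Sum>i\<in>I. \<phi> (s * m i)) + (\<Sum>i\<in>J. \<phi> (chi \<phi> \<phi>' s (ennreal (y i)))))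
      / P (ennreal (real (card I) * f s))) \<longlongrightarrow>
      exp (- (((\<Sum>i\<in>J. inverse (y i)) - (\<Sum>i\<in>I. ln (m i))) * real (card I) powr (- \<kappa>)))) (at_right 0)"
proof -
  define k where "k = real (card I)"
  have k: "k \<ge> 1"
    using I card_gt_0_iff[of I] by (simp add: k_def Suc_le_eq)
  define v where "v s = (\<Sum>i\<in>I. (f (s * m i) - f s) / q s) + (\<Sum>i\<in>J. inverse (y i))" for s
  have "(v \<longlongrightarrow> (\<Sum>i\<in>I. - ln (m i)) + (\<Sum>i\<in>J. inverse (y i))) (at_right 0)"
    unfolding v_def by (intro tendsto_intros f_diff m)
  then have "(v \<longlongrightarrow> (\<Sum>i\<in>J. inverse (y i)) - (\<Sum>i\<in>I. ln (m i))) (at_right 0)"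
    by (simp add: sum_negf)
  from P_limit[OF k this]
  have "((\<lambda>s. P (ennreal (k * f s + v s * q s)) / P (ennreal (k * f s))) \<longlongrightarrow>
    exp (- (((\<Sum>i\<in>J. inverse (y i)) - (\<Sum>i\<in>I. ln (m i))) * k powr (- \<kappa>)))) (at_right 0)" .
  moreover have "\<forall>\<^sub>F s in at_right 0. P (ennreal (k * f s + v s * q s)) / P (ennreal (k * f s)) =
      P ((\<Sum>i\<in>I. \<phi> (s * m i)) + (\<Sum>i\<in>J. \<phi> (chi \<phi> \<phi>' s (ennreal (y i))))) / P (ennreal (k * f s))"
  proof -
    \<comment> \<open>This keeps every \<open>s * m i\<close> in (0,1), where \<open>\<phi>\<close>
      is finite and agrees with \<open>f\<close>.\<close>
    have "\<forall>\<^sub>F s in at_right 0. \<forall>i\<in>I. 0 < s \<and> s < 1 / m i"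
      using I m by (intro eventually_ball_finite) (auto intro!: eventually_at_right_0)
    then show ?thesis
      using eventually_at_right_0[OF zero_less_one]
    proof eventually_elim
      case (elim s)
      have q: "q s > 0" using elim q_pos by auto
      have "(\<Sum>i\<in>I. \<phi> (s * m i)) = (\<Sum>i\<in>I. ennreal (f (s * m i)))"
        using elim m by (intro sum.cong refl gen_eq) (auto simp: field_simps)
      also have "\<dots> = ennreal (\<Sum>i\<in>I. f (s * m i))"
        by (simp add: f_nonneg)
      finally have 1: "(\<Sum>i\<in>I. \<phi> (s * m i)) = ennreal (\<Sum>i\<in>I. f (s * m i))" .
      have "(\<Sum>i\<in>J. \<phi> (chi \<phi> \<phi>' s (ennreal (y i)))) = (\<Sum>i\<in>J. ennreal (inverse (y i) * q s))"
        using elim y q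
        by (intro sum.cong refl) (simp add: chi_eq gen_P inverse_ennreal ennreal_mult'')
      also have "\<dots> = ennreal (\<Sum>i\<in>J. inverse (y i) * q s)"
        using y q by (intro sum_ennreal) (auto intro!: mult_nonneg_nonneg less_imp_le)
      finally have 2: "(\<Sum>i\<in>J. \<phi> (chi \<phi> \<phi>' s (ennreal (y i)))) = ennreal (\<Sum>i\<in>J. inverse (y i) * q s)" .
      have "k * f s + v s * q s = (\<Sum>i\<in>I. f (s * m i)) + (\<Sum>i\<in>J. inverse (y i) * q s)"
        using q by (simp add: v_def k_def distrib_right sum_distrib_right sum_subtractf)
      moreover have "ennreal ((\<Sum>i\<in>I. f (s * m i)) + (\<Sum>i\<in>J. inverse (y i) * q s)) =
          ennreal (\<Sum>i\<in>I. f (s * m i)) + ennreal (\<Sum>i\<in>J. inverse (y i) * q s)"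
        using y q by (intro ennreal_plus sum_nonneg) (auto simp: f_nonneg intro!: mult_nonneg_nonneg less_imp_le)
      ultimately show ?case
        by (simp add: 1 2)
    qed
  qed
  ultimately show ?thesis
    unfolding k_def by (rule Lim_transform_eventually)
qed

end

section \<open>Copulas\<close>

text \<open>Absent constraints are imposed as bounds by 1: they add \<open>\<phi> 1 = 0\<close> to
  the sum, and they hold almost surely because the distribution function equals 1 at
  (1,...,1).\<close>

lemma distribution_function_partial:
  assumes M: "prob_space M" and X: "has_distribution_function d M X (archimedean_copula d \<phi>)"
    and \<phi>: "\<phi> 1 = 0" "gen_inverse \<phi> 0 = 1"
    and I: "I \<subseteq> {1..d}" and u: "\<And>i. i \<in> I \<Longrightarrow> u i \<in> {0..1}"
  shows "measure M {\<omega> \<in> space M. \<forall>i\<in>I. X i \<omega> \<le> u i} = gen_inverse \<phi> (\<Sum>i\<in>I. \<phi> (u i))"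
proof -
  interpret prob_space M by fact
  have [measurable]: "X i \<in> borel_measurable M" if "i \<in> {1..d}" for i
    using X that by (auto simp: has_distribution_function_def)
  have cdf: "measure M {\<omega> \<in> space M. \<forall>i\<in>{1..d}. X i \<omega> \<le> u i} = archimedean_copula d \<phi> u"
    if "\<forall>i\<in>{1..d}. u i \<in> {0..1}" for u
    using X that unfolding has_distribution_function_def by blast
  have "finite I" using I finite_subset by blast
  have le_1: "AE \<omega> in M. \<forall>i\<in>{1..d}. X i \<omega> \<le> 1"
  proof -
    have "measure M {\<omega> \<in> space M. \<forall>i\<in>{1..d}. X i \<omega> \<le> 1} = 1"
      using cdf[of "\<lambda>_. 1"] by (simp add: archimedean_copula_def \<phi>)
    moreover have "{\<omega> \<in> space M. \<forall>i\<in>{1..d}. X i \<omega> \<le> 1} \<in> events" by measurable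
    ultimately show ?thesis
      by (subst (asm) prob_Collect_eq_1) auto
  qed
  define u' where "u' i = (if i \<in> I then u i else 1)" for i
  have "measure M {\<omega> \<in> space M. \<forall>i\<in>I. X i \<omega> \<le> u i} = measure M {\<omega> \<in> space M. \<forall>i\<in>{1..d}. X i \<omega> \<le> u' i}"
  proof (rule finite_measure_eq_AE)
    show "AE \<omega> in M. (\<omega> \<in> {\<omega> \<in> space M. \<forall>i\<in>I. X i \<omega> \<le> u i}) = (\<omega> \<in> {\<omega> \<in> space M. \<forall>i\<in>{1..d}. X i \<omega> \<le> u' i})"
      using le_1 by eventually_elim (use I in \<open>auto simp: u'_def\<close>)
    have [measurable]: "X i \<in> borel_measurable M" if "i \<in> I" for i
      using I that by auto
    show "{\<omega> \<in> space M. \<forall>i\<in>I. X i \<omega> \<le> u i} \<in> events"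
      using \<open>finite I\<close> by measurable
    show "{\<omega> \<in> space M. \<forall>i\<in>{1..d}. X i \<omega> \<le> u' i} \<in> events"
      by measurable
  qed
  also have "\<dots> = gen_inverse \<phi> (\<Sum>i\<in>{1..d}. \<phi> (u' i))"
    using u by (subst cdf) (auto simp: u'_def archimedean_copula_def)
  also have "(\<Sum>i\<in>{1..d}. \<phi> (u' i)) = (\<Sum>i\<in>I. \<phi> (u i))"
    using I by (intro sum.mono_neutral_cong_right) (auto simp: u'_def \<phi>)
  finally show ?thesis .
qed

text \<open>At (u,1,...,1) the copula formula collapses to \<open>P\<close> of
  \<open>\<phi> u\<close>, while the probability it represents is the first margin at u, which is
  uniform.\<close>

lemma copula_gen_inverse:
  assumes "2 \<le> d" and C: "is_copula d (archimedean_copula d \<phi>)" and \<phi>: "\<phi> 1 = 0"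
    and u: "u \<in> {0..1}"
  shows "gen_inverse \<phi> (\<phi> u) = u"
proof -
  from C obtain N where N: "prob_space N" and sets: "sets N = sets (Pi\<^sub>M {1..d} (\<lambda>_. borel))"
    and X: "has_distribution_function d N (\<lambda>i x. x i) (archimedean_copula d \<phi>)"
    and D: "\<And>i. i \<in> {1..d} \<Longrightarrow> distr N borel (\<lambda>x. x i) = uniform_measure lborel {0<..<1}"
    by (auto simp: is_copula_def)
  interpret prob_space N by fact
  have [measurable]: "(\<lambda>x. x i) \<in> borel_measurable N" if "i \<in> {1..d}" for i
    using X that by (auto simp: has_distribution_function_def)
  have cdf: "measure N {x \<in> space N. \<forall>i\<in>{1..d}. x i \<le> v i} = archimedean_copula d \<phi> v"
    if "\<forall>i\<in>{1..d}. v i \<in> {0..1}" for v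
    using X that unfolding has_distribution_function_def by blast
  have margin: "measure N {x \<in> space N. x i \<le> t} = t" if i: "i \<in> {1..d}" and t: "t \<in> {0..1}" for i t
  proof -
    have "measure N {x \<in> space N. x i \<le> t} = measure (distr N borel (\<lambda>x. x i)) {..t}"
      using i by (subst measure_distr) (auto intro!: arg_cong[where f = "measure N"])
    also have "\<dots> = measure lborel ({0<..<1} \<inter> {..t}) / measure lborel {0<..<1::real}"
      using i by (simp add: D measure_uniform_measure)
    also have "measure lborel ({0<..<1} \<inter> {..t}) = t"
    \<comment> \<open>The uniform law is taken on an interval open at 1, so the intersection is
      closed on the right except when t = 1.\<close>
    proof (cases "t = 1")
      case True
      then have "{0<..<1} \<inter> {..t} = {0<..<1}" by auto
      then show ?thesis using True by simp
    next
      case False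
      then have "{0<..<1} \<inter> {..t} = {0<..t}" using t by auto
      then show ?thesis using t by simp
    qed
    finally show ?thesis by simp
  qed
  have le_1: "AE x in N. x i \<le> 1" if "i \<in> {1..d}" for i
    by (rule prob_Collect_eq_1[THEN iffD1]) (use margin[OF that, of 1] that in auto)
  have all_le_1: "AE x in N. \<forall>i\<in>{1..d}. x i \<le> 1"
    using le_1 by (simp add: AE_finite_all)
  have 1: "1 \<in> {1..d}" using \<open>2 \<le> d\<close> by simp
  define w where "w i = (if i = 1 then u else 1)" for i :: nat
  have "gen_inverse \<phi> (\<phi> u) = archimedean_copula d \<phi> w"
  proof -
    have "(\<Sum>i\<in>{1..d}. \<phi> (w i)) = (\<Sum>i\<in>{1}. \<phi> (w i))"
      using 1 by (intro sum.mono_neutral_right) (auto simp: w_def \<phi>)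
    then show ?thesis by (simp add: archimedean_copula_def w_def)
  qed
  also have "\<dots> = measure N {x \<in> space N. \<forall>i\<in>{1..d}. x i \<le> w i}"
    using u by (intro cdf[symmetric]) (auto simp: w_def)
  also have "\<dots> = measure N {x \<in> space N. x 1 \<le> u}"
  proof (rule finite_measure_eq_AE)
    show "AE x in N. (x \<in> {x \<in> space N. \<forall>i\<in>{1..d}. x i \<le> w i}) = (x \<in> {x \<in> space N. x 1 \<le> u})"
      using all_le_1 by eventually_elim (use 1 in \<open>auto simp: w_def\<close>)
    show "{x \<in> space N. \<forall>i\<in>{1..d}. x i \<le> w i} \<in> events"
      by measurable
    show "{x \<in> space N. x 1 \<le> u} \<in> events"
      using 1 by measurable
  qed
  also have "\<dots> = u" by (rule margin[OF 1 u])
  finally show ?thesis .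
qed

theorem theorem3p4:
  fixes d :: nat and \<phi> :: "real \<Rightarrow> ennreal" and \<phi>' :: "real \<Rightarrow> real" and \<kappa> :: real
    and M :: "'a measure" and U :: "nat \<Rightarrow> 'a \<Rightarrow> real"
  assumes "2 \<le> d"
    and "archimedean_generator \<phi>"
    and "is_copula d (archimedean_copula d \<phi>)"
    and "generator_derivative \<phi> \<phi>'"
    and "prob_space M"
    and "has_distribution_function d M U (archimedean_copula d \<phi>)"
    and "\<phi> 0 = \<infinity>"
    and "((\<lambda>s. s * \<phi>' s / enn2real (\<phi> s)) \<longlongrightarrow> 0) (at_right 0)"
    and "regularly_varying_at_infinity (psi \<phi> \<phi>') \<kappa>"
  shows
    "(\<forall>I x y. I \<noteq> {} \<and> I \<subseteq> {1..d} \<and> (\<forall>i\<in>I. (x i :: real) > 0) \<and> (\<forall>i\<in>{1..d}. (y i :: real) > 0) \<longrightarrow>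
       ((\<lambda>s. \<P>(\<omega> in M.
               (\<forall>i\<in>I. U i \<omega> \<le> s * y i) \<and>
               (\<forall>i\<in>{1..d} - I. U i \<omega> \<le> chi \<phi> \<phi>' s (ennreal (y i)))
               \<bar> \<forall>i\<in>I. U i \<omega> \<le> s * x i))
         \<longlongrightarrow> (\<Prod>i\<in>I. min (y i / x i) 1 powr (real (card I) powr (- \<kappa>))) *
             (\<Prod>i\<in>{1..d} - I. exp (- (real (card I) powr (- \<kappa>)) * inverse (y i))))
         (at_right 0)) \<and>
     (\<forall>s. 0 < s \<and> s < 1 \<longrightarrow>
        strict_mono (chi \<phi> \<phi>' s) \<and> (\<exists>g. homeomorphism UNIV {0..1} (chi \<phi> \<phi>' s) g)) \<and>
     (\<forall>y::real. 0 < y \<longrightarrow> ((\<lambda>s. s / chi \<phi> \<phi>' s (ennreal y)) \<longlongrightarrow> 0) (at_right 0))"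
proof -
  have \<phi>1: "\<phi> 1 = 0"
    using assms(2) by (simp add: archimedean_generator_def)
  interpret slow_generator \<phi> \<phi>' \<kappa>
    using assms copula_gen_inverse[OF assms(1,3) \<phi>1] by unfold_locales auto
  have P0: "gen_inverse \<phi> 0 = 1"
    using gen_inverse_gen[of 1] by (simp add: \<phi>1)
  note partial = distribution_function_partial[OF assms(5,6) \<phi>1 P0]
  have main: "((\<lambda>s. \<P>(\<omega> in M.
           (\<forall>i\<in>I. U i \<omega> \<le> s * y i) \<and>
           (\<forall>i\<in>{1..d} - I. U i \<omega> \<le> chi \<phi> \<phi>' s (ennreal (y i)))
           \<bar> \<forall>i\<in>I. U i \<omega> \<le> s * x i))
       \<longlongrightarrow> (\<Prod>i\<in>I. min (y i / x i) 1 powr (real (card I) powr (- \<kappa>))) *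
           (\<Prod>i\<in>{1..d} - I. exp (- (real (card I) powr (- \<kappa>)) * inverse (y i))))
       (at_right 0)"
    if I: "I \<noteq> {}" "I \<subseteq> {1..d}" and x: "\<And>i. i \<in> I \<Longrightarrow> x i > 0"
      and y: "\<And>i. i \<in> {1..d} \<Longrightarrow> y i > 0" for I and x y :: "nat \<Rightarrow> real"
  proof -
    define J where "J = {1..d} - I"
    define K where "K = real (card I) powr (- \<kappa>)"
    \<comment> \<open>Intersecting with the conditioning event caps each coordinate in
      \<open>I\<close> at the smaller of its two bounds, which is the origin of the minimum in the
      limit.\<close>
    define m where "m i = min (y i) (x i)" for i
    have fin: "finite I" "finite J"
      using I finite_subset by (auto simp: J_def)
    have yI: "y i > 0" if "i \<in> I" for i using y I that by blast
    have m: "m i > 0" if "i \<in> I" for i using x[OF that] yI[OF that] by (simp add: m_def)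
    have yJ: "y i > 0" if "i \<in> J" for i using y that by (simp add: J_def)
    define B where "B s = P (ennreal (real (card I) * f s))" for s
    define num where "num s = P ((\<Sum>i\<in>I. \<phi> (s * m i)) + (\<Sum>i\<in>J. \<phi> (chi \<phi> \<phi>' s (ennreal (y i)))))" for s
    define den where "den s = P (\<Sum>i\<in>I. \<phi> (s * x i))" for s
    have "((\<lambda>s. num s / B s) \<longlongrightarrow> exp (- (((\<Sum>i\<in>J. inverse (y i)) - (\<Sum>i\<in>I. ln (m i))) * K))) (at_right 0)"
      unfolding num_def B_def K_def using fin I m yJ by (intro sum_gen_limit) auto
    \<comment> \<open>The same limit with no coordinates outside \<open>I\<close>: the normaliser
      \<open>B\<close> depends on \<open>I\<close> through its cardinality, so it is common to both
      quotients.\<close>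
    moreover have "((\<lambda>s. den s / B s) \<longlongrightarrow> exp (- ((0 - (\<Sum>i\<in>I. ln (x i))) * K))) (at_right 0)"
      using sum_gen_limit[of I "{}" x] fin I x by (simp add: den_def B_def K_def)
    ultimately have "((\<lambda>s. (num s / B s) / (den s / B s)) \<longlongrightarrow>
        exp (- (((\<Sum>i\<in>J. inverse (y i)) - (\<Sum>i\<in>I. ln (m i))) * K)) / exp (- ((0 - (\<Sum>i\<in>I. ln (x i))) * K)))
        (at_right 0)"
      by (rule tendsto_divide) simp
    moreover have "exp (- (((\<Sum>i\<in>J. inverse (y i)) - (\<Sum>i\<in>I. ln (m i))) * K)) / exp (- ((0 - (\<Sum>i\<in>I. ln (x i))) * K))
        = (\<Prod>i\<in>I. min (y i / x i) 1 powr K) * (\<Prod>i\<in>J. exp (- K * inverse (y i)))"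
    proof -
      have "min (y i / x i) 1 powr K = exp ((ln (m i) - ln (x i)) * K)" if "i \<in> I" for i
      proof -
        have "min (y i / x i) 1 = m i / x i"
          using x[OF that] by (auto simp: m_def min_def field_simps)
        then show ?thesis
          using x[OF that] m[OF that] by (simp add: powr_def ln_div mult.commute)
      qed
      then have "(\<Prod>i\<in>I. min (y i / x i) 1 powr K) = exp (\<Sum>i\<in>I. (ln (m i) - ln (x i)) * K)"
        using fin by (simp add: exp_sum)
      moreover have "(\<Prod>i\<in>J. exp (- K * inverse (y i))) = exp (\<Sum>i\<in>J. - K * inverse (y i))"
        using fin by (simp add: exp_sum)
      moreover have "(\<Sum>i\<in>J. - K * inverse (y i)) = - K * (\<Sum>i\<in>J. inverse (y i))"
        by (rule sum_distrib_left[symmetric])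
      moreover have "(\<Sum>i\<in>I. (ln (m i) - ln (x i)) * K) = ((\<Sum>i\<in>I. ln (m i)) - (\<Sum>i\<in>I. ln (x i))) * K"
        by (simp add: sum_distrib_right[symmetric] sum_subtractf)
      ultimately show ?thesis
        by (simp add: exp_add[symmetric] exp_diff[symmetric] algebra_simps)
    qed
    moreover have "\<forall>\<^sub>F s in at_right 0. (num s / B s) / (den s / B s) =
        \<P>(\<omega> in M. (\<forall>i\<in>I. U i \<omega> \<le> s * y i) \<and>
           (\<forall>i\<in>J. U i \<omega> \<le> chi \<phi> \<phi>' s (ennreal (y i))) \<bar> \<forall>i\<in>I. U i \<omega> \<le> s * x i)"
    proof -
      have "\<forall>\<^sub>F s in at_right 0. \<forall>i\<in>I. 0 < s \<and> s < 1 / x i"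
        using fin x by (intro eventually_ball_finite) (auto intro!: eventually_at_right_0)
      then show ?thesis
        using eventually_at_right_0[OF zero_less_one]
      proof eventually_elim
        case (elim s)
        have xs: "s * x i \<in> {0..1}" "s * m i \<in> {0..1}" if "i \<in> I" for i
        proof -
          have "s * m i \<le> s * x i" using elim by (intro mult_left_mono) (auto simp: m_def)
          moreover have "s * x i < 1" using elim that x[OF that] by (auto simp: field_simps)
          moreover have "0 < s * m i" using elim m[OF that] by simp
          ultimately show "s * x i \<in> {0..1}" "s * m i \<in> {0..1}"
            unfolding atLeastAtMost_iff by linarith+
        qed
        have "measure M {\<omega> \<in> space M. \<forall>i\<in>I. U i \<omega> \<le> s * x i} = den s"
          unfolding den_def using I xs by (intro partial) auto
        moreover have "measure M {\<omega> \<in> space M. ((\<forall>i\<in>I. U i \<omega> \<le> s * y i) \<and>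
           (\<forall>i\<in>J. U i \<omega> \<le> chi \<phi> \<phi>' s (ennreal (y i)))) \<and> (\<forall>i\<in>I. U i \<omega> \<le> s * x i)} = num s"
        proof -
          define w where "w i = (if i \<in> I then s * m i else chi \<phi> \<phi>' s (ennreal (y i)))" for i
          have "U i \<omega> \<le> s * m i \<longleftrightarrow> U i \<omega> \<le> s * y i \<and> U i \<omega> \<le> s * x i" for i \<omega>
            using elim by (auto simp: m_def min_mult_distrib_left)
          then have "{\<omega> \<in> space M. ((\<forall>i\<in>I. U i \<omega> \<le> s * y i) \<and>
             (\<forall>i\<in>J. U i \<omega> \<le> chi \<phi> \<phi>' s (ennreal (y i)))) \<and> (\<forall>i\<in>I. U i \<omega> \<le> s * x i)}
             = {\<omega> \<in> space M. \<forall>i\<in>I \<union> J. U i \<omega> \<le> w i}"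
            by (auto simp: w_def J_def)
          moreover have "measure M {\<omega> \<in> space M. \<forall>i\<in>I \<union> J. U i \<omega> \<le> w i} = P (\<Sum>i\<in>I \<union> J. \<phi> (w i))"
            using I xs chi_range[of s] elim by (intro partial) (auto simp: w_def J_def)
          moreover have "(\<Sum>i\<in>I \<union> J. \<phi> (w i)) =
              (\<Sum>i\<in>I. \<phi> (s * m i)) + (\<Sum>i\<in>J. \<phi> (chi \<phi> \<phi>' s (ennreal (y i))))"
            using fin by (subst sum.union_disjoint) (auto simp: w_def J_def intro!: sum.cong arg_cong2[where f = "(+)"])
          ultimately show ?thesis by (simp add: num_def)
        qed
        moreover have "B s > 0" by (simp add: B_def P_pos)
        ultimately show ?case by (simp add: cond_prob_def)
      qed
    qed
    ultimately show ?thesis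
      unfolding J_def[symmetric] K_def[symmetric] by (simp add: Lim_transform_eventually)
  qed
  show ?thesis
    by (intro conjI allI impI main chi_strict_mono chi_homeomorphism chi_ratio) auto
qed

end
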